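(* Let $u\ge1$ be an integer, $p=q=1/2$, and let $X_{n,s}$ be the number of turns required to end the single-player pile game with boundary with set of choices $R=\{1,-u\}$ and target $n$, starting with $s$ chips. Then $$E[X_{n,s}]=2\,[C_u(n)-C_u(s)],\qquad 0\le s\le n,$$ where $C_u$ is defined by $C_u(0)=C_u(-1)=\dots=C_u(-u)=0$ and $$C_u(n)=2C_u(n-1)+1-C_u(n-u-1)\qquad(n\ge1).$$
   Context: Single-player pile game with boundary, $R=\{1,-u\}$: the player starts with $s$ chips, $0\le s\le n$. In each turn, independently, the number of chips $c$ is replaced by $c+1$ with probability $p$ and by $\max(0,c-u)$ with probability $q=1-p$. The game ends when the player first has $n$ chips (at turn $0$ if $s=n$). *)

theory Defs
  imports "HOL-Probability.Probability"
begin

text \<open>\<open>chips s r t\<close> is the number of chips after \<open>t\<close> turns when the \<open>k\<close>-th turn adds the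
  (possibly negative) amount \<open>r k\<close> to the pile. The process is not frozen when the target is
  reached; this has no effect on the first hitting time below.\<close>

primrec chips :: "int \<Rightarrow> (nat \<Rightarrow> int) \<Rightarrow> nat \<Rightarrow> int" where
  "chips s r 0 = s"
| "chips s r (Suc t) = max 0 (chips s r t + r t)"

text \<open>The infimum of the empty set is \<open>\<infinity>\<close>, so a game that never ends takes \<open>\<infinity>\<close> turns.\<close>

definition turns :: "int \<Rightarrow> int \<Rightarrow> (nat \<Rightarrow> int) \<Rightarrow> enat" where
  "turns n s r = (INF t \<in> {t. chips s r t = n}. enat t)"

text \<open>The values at arguments below \<open>- int u\<close> are junk: for \<open>m \<ge> 1\<close> the recurrence refers only to
  arguments \<open>\<ge> - int u\<close>.\<close>

function C :: "nat \<Rightarrow> int \<Rightarrow> int" where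
  "C u m = (if m \<le> 0 then 0 else 2 * C u (m - 1) + 1 - C u (m - int u - 1))"
  by auto
termination
  by (relation "Wellfounded.measure (\<lambda>(u, m). nat m)") auto

declare C.simps [simp del]

end

theory Submission
  imports Defs
begin

text \<open>The function \<open>h x = 2 (C u n - C u x)\<close> satisfies the first-step equation
  \<open>h x = 1 + (h (x + 1) + h (max 0 (x - u))) / 2\<close> for \<open>0 \<le> x < n\<close> and \<open>h n = 0\<close>. If \<open>A\<^sub>t\<close> is the
  event that the game is still running after turn \<open>t\<close> and \<open>X\<^sub>t\<close> is the pile, then
  \<open>E[h(X\<^sub>t\<^sub>+\<^sub>1) 1\<^bsub>A(t+1)\<^esub>] = E[h(X\<^sub>t) 1\<^bsub>A(t)\<^esub>] - P(A\<^sub>t)\<close>, hence the sum of \<open>P(A\<^sub>k)\<close> over \<open>k < t\<close> is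
  \<open>h s - E[h(X\<^sub>t) 1\<^bsub>A(t)\<^esub>]\<close>. As \<open>h\<close> is nonnegative and bounded on \<open>{0..n}\<close>, the series converges,
  so \<open>P(A\<^sub>t)\<close> and with it the error term tend to \<open>0\<close>.\<close>

section \<open>Monotonicity of \<open>C\<close> and its first-step identity\<close>

lemma C_nonpos: "m \<le> 0 \<Longrightarrow> C u m = 0"
  by (subst C.simps) simp

lemma C_rec: "m > 0 \<Longrightarrow> C u m = 2 * C u (m - 1) + 1 - C u (m - int u - 1)"
  by (subst C.simps) simp

text \<open>Each increment is \<open>C u b - C u (b - 1) = 1 + (C u (b - 1) - C u (b - int u -
  1))\<close>, which is positive once \<open>C\<close> is known to be monotone below
  \<open>b\<close>. This is what bounds \<open>h\<close> on \<open>{0..n}\<close>.\<close>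

lemma C_mono:
  assumes "a \<le> b"
  shows "C u a \<le> C u b"
proof -
  \<comment> \<open>Comparing with every smaller argument, not just the predecessor, lets the
    hypothesis reach back to \<open>b - int u - 1\<close>.\<close>
  have "\<forall>a\<le>b. C u a \<le> C u b" for b
  proof (induction "nat b" arbitrary: b rule: less_induct)
    case less
    show ?case
    proof (cases "b \<le> 0")
      case True
      then show ?thesis by (simp add: C_nonpos)
    next
      case False
      then have IH: "\<forall>a\<le>b - 1. C u a \<le> C u (b - 1)"
        using less[of "b - 1"] by simp
      moreover have "C u (b - 1) \<le> C u b"
        using C_rec[of b u] IH[rule_format, of "b - int u - 1"] False by linarith
      ultimately show ?thesis
        by (metis order_trans order_refl zle_diff1_eq order_le_less)
    qed
  qed
  with assms show ?thesis by blast
qed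

lemma C_first_step:
  assumes "0 \<le> x"
  shows "C u (x + 1) + C u (max 0 (x - int u)) = 2 * C u x + 1"
proof -
  \<comment> \<open>The zero values of \<open>C\<close> at nonpositive arguments encode the
    truncation of the pile at 0.\<close>
  have "C u (max 0 (x - int u)) = C u (x - int u)"
    by (cases "x \<le> int u") (auto simp: C_nonpos max_def)
  with C_rec[of "x + 1" u] assms show ?thesis by simp
qed

section \<open>Single paths: the pile, the hitting time and the running game\<close>

lemma chips_cong: "(\<And>i. i < t \<Longrightarrow> r i = r' i) \<Longrightarrow> chips s r t = chips s r' t"
  by (induction t) auto

lemma chips_nonneg: "0 \<le> s \<Longrightarrow> 0 \<le> chips s r t"
  by (cases t) auto

text \<open>The index set stays general for two uses: \<open>UNIV\<close> for the whole random path,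
  and \<open>{..<t}\<close> for the past in the independence argument.\<close>

lemma measurable_chips:
  assumes "{..<t} \<subseteq> I"
  shows "(\<lambda>r. chips s r t) \<in> measurable (PiM I (\<lambda>_. count_space UNIV)) (count_space UNIV)"
  using assms
proof (induction t)
  case (Suc t)
  have [measurable]: "(\<lambda>r. chips s r t) \<in> measurable (PiM I (\<lambda>_. count_space UNIV)) (count_space UNIV)"
    by (rule Suc.IH) (use Suc.prems in force)
  \<comment> \<open>The current pile has countably many possible values, so it may be replaced by a
    constant \<open>k\<close>.\<close>
  have "(\<lambda>r. max 0 (k + r t)) \<in> measurable (PiM I (\<lambda>_. count_space UNIV)) (count_space UNIV)" for k
    by (rule measurable_PiM_component_rev) (use Suc.prems in auto)
  then show ?case
    unfolding chips.simps by (rule measurable_compose_countable) measurable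
qed simp

lemma less_turns_iff: "enat t < turns n s r \<longleftrightarrow> (\<forall>k\<le>t. chips s r k \<noteq> n)"
proof
  assume less: "enat t < turns n s r"
  show "\<forall>k\<le>t. chips s r k \<noteq> n"
  proof (intro allI impI notI)
    fix k assume "k \<le> t" "chips s r k = n"
    then have "turns n s r \<le> enat k"
      unfolding turns_def by (intro INF_lower) auto
    with less have "enat t < enat k" by (rule less_le_trans)
    with \<open>k \<le> t\<close> show False by simp
  qed
next
  assume "\<forall>k\<le>t. chips s r k \<noteq> n"
  \<comment> \<open>A strict bound on an infimum becomes a lower bound by \<open>Suc t\<close> on
    every hitting index; this also covers a path that never hits.\<close>
  then have "enat (Suc t) \<le> turns n s r"
    unfolding turns_def by (intro INF_greatest) (auto simp: not_less_eq_eq)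
  then show "enat t < turns n s r"
    using Suc_ile_eq by blast
qed

text \<open>With \<open>< n\<close> instead of \<open>\<noteq> n\<close>, the pile stays below the
  target on every path, even on the null set of paths with other step sizes. Bounds then hold
  everywhere, not only almost everywhere.\<close>

definition running :: "int \<Rightarrow> int \<Rightarrow> (nat \<Rightarrow> int) \<Rightarrow> nat \<Rightarrow> bool" where
  "running n s r t \<longleftrightarrow> (\<forall>k\<le>t. chips s r k < n)"

lemma running_cong: "(\<And>i. i < t \<Longrightarrow> r i = r' i) \<Longrightarrow> running n s r t = running n s r' t"
  unfolding running_def using chips_cong by (metis order_less_le_trans)

lemma measurable_running:
  assumes "{..<t} \<subseteq> I"
  shows "Measurable.pred (PiM I (\<lambda>_. count_space UNIV)) (\<lambda>r. running n s r t)"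
proof -
  have [measurable]: "k \<in> {..t} \<Longrightarrow> (\<lambda>r. chips s r k) \<in> measurable (PiM I (\<lambda>_. count_space UNIV)) (count_space UNIV)" for k
    using assms by (intro measurable_chips) auto
  have "Measurable.pred (PiM I (\<lambda>_. count_space UNIV)) (\<lambda>r. \<forall>k\<in>{..t}. chips s r k < n)"
    by measurable
  then show ?thesis by (simp add: running_def Ball_def)
qed

text \<open>Upward moves have size one, so the pile cannot jump over the target.\<close>

lemma running_iff:
  assumes "s \<le> n" "\<And>t. r t \<le> 1" "0 \<le> s"
  shows "running n s r t \<longleftrightarrow> (\<forall>k\<le>t. chips s r k \<noteq> n)"
proof (induction t)
  case 0
  then show ?case using assms by (auto simp: running_def)
next
  case (Suc t)
  have le: "chips s r (Suc t) \<le> n" if "chips s r t < n"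
    using that assms(2)[of t] chips_nonneg[OF assms(3), of r t] by simp
  have "running n s r (Suc t) \<longleftrightarrow> running n s r t \<and> chips s r (Suc t) < n"
    by (auto simp: running_def le_Suc_eq)
  also have "\<dots> \<longleftrightarrow> running n s r t \<and> chips s r (Suc t) \<noteq> n"
    using le by (force simp: running_def simp del: chips.simps)
  finally show ?case by (auto simp: Suc le_Suc_eq simp del: chips.simps)
qed

section \<open>The random game: measurability and almost sure step values\<close>

locale pile_game = prob_space M for M :: "'a measure" +
  fixes \<xi> :: "nat \<Rightarrow> 'a \<Rightarrow> int" and u :: nat and n s :: int
  assumes u: "u \<ge> 1"
    and indep: "indep_vars (\<lambda>_. count_space UNIV) \<xi> UNIV"
    and prob_up: "\<And>t. prob {\<omega> \<in> space M. \<xi> t \<omega> = 1} = 1 / 2"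
    and prob_down: "\<And>t. prob {\<omega> \<in> space M. \<xi> t \<omega> = - int u} = 1 / 2"
    and s: "0 \<le> s" "s \<le> n"
begin

abbreviation pile :: "nat \<Rightarrow> 'a \<Rightarrow> int" where
  "pile t \<omega> \<equiv> chips s (\<lambda>i. \<xi> i \<omega>) t"

abbreviation alive :: "nat \<Rightarrow> 'a \<Rightarrow> bool" where
  "alive t \<omega> \<equiv> running n s (\<lambda>i. \<xi> i \<omega>) t"

definition h :: "int \<Rightarrow> real" where
  "h x = 2 * (real_of_int (C u n) - real_of_int (C u x))"

lemma measurable_\<xi> [measurable]: "\<xi> t \<in> measurable M (count_space UNIV)"
  using indep by (auto simp: indep_vars_def)

lemma measurable_path: "(\<lambda>\<omega> i. \<xi> i \<omega>) \<in> measurable M (PiM UNIV (\<lambda>_. count_space UNIV))"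
  by (intro measurable_PiM_single') (auto simp: measurable_\<xi>)

lemma measurable_pile [measurable]: "pile t \<in> measurable M (count_space UNIV)"
  using measurable_compose[OF measurable_path measurable_chips] by simp

lemma measurable_alive [measurable]: "Measurable.pred M (alive t)"
  using measurable_compose[OF measurable_path measurable_running] by simp

text \<open>Two disjoint events of probability 1/2 exhaust the mass; countably many null sets are
  then combined.\<close>

lemma AE_step: "AE \<omega> in M. \<forall>t. \<xi> t \<omega> = 1 \<or> \<xi> t \<omega> = - int u"
proof -
  have "AE \<omega> in M. \<xi> t \<omega> = 1 \<or> \<xi> t \<omega> = - int u" for t
  proof -
    have "prob ({\<omega> \<in> space M. \<xi> t \<omega> = 1} \<union> {\<omega> \<in> space M. \<xi> t \<omega> = - int u})
        = prob {\<omega> \<in> space M. \<xi> t \<omega> = 1} + prob {\<omega> \<in> space M. \<xi> t \<omega> = - int u}"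
      by (intro finite_measure_Union) auto
    also have "\<dots> = 1" by (simp add: prob_up prob_down)
    finally have "prob {\<omega> \<in> space M. \<xi> t \<omega> = 1 \<or> \<xi> t \<omega> = - int u} = 1"
      by (simp add: Collect_disj_eq[symmetric] Un_def conj_disj_distribL cong: conj_cong)
    then show ?thesis
      by (subst (asm) prob_Collect_eq_1) auto
  qed
  then show ?thesis by (simp add: AE_all_countable)
qed

section \<open>Expectations restricted to the running game\<close>

lemma bounded_on_alive: "\<exists>B. \<forall>\<omega> t. \<bar>of_bool (alive t \<omega>) * f (pile t \<omega>)\<bar> \<le> (B :: real)"
proof (intro exI allI)
  fix \<omega> t
  \<comment> \<open>A running pile lies in the finite set \<open>{0..n}\<close>, so the sum of all
    absolute values there bounds an arbitrary \<open>f\<close>.\<close>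
  show "\<bar>of_bool (alive t \<omega>) * f (pile t \<omega>)\<bar> \<le> (\<Sum>x\<in>{0..n}. \<bar>f x\<bar>)"
  proof (cases "alive t \<omega>")
    case True
    then have "pile t \<omega> \<in> {0..n}"
      using chips_nonneg[OF s(1)] by (force simp: running_def)
    then have "\<bar>f (pile t \<omega>)\<bar> \<le> (\<Sum>x\<in>{0..n}. \<bar>f x\<bar>)"
      by (intro member_le_sum) auto
    with True show ?thesis by simp
  qed (simp add: sum_nonneg)
qed

lemma measurable_alive_mult [measurable]:
  "(\<lambda>\<omega>. of_bool (alive t \<omega>) * f (pile t \<omega>) :: real) \<in> borel_measurable M"
  by measurable

lemma integrable_alive: "integrable M (\<lambda>\<omega>. of_bool (alive t \<omega>) * f (pile t \<omega>) :: real)"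
proof -
  obtain B where "\<forall>\<omega> t. \<bar>of_bool (alive t \<omega>) * f (pile t \<omega>)\<bar> \<le> B"
    using bounded_on_alive by blast
  then show ?thesis by (intro integrable_const_bound[where B=B]) auto
qed

text \<open>\<open>Y\<close> is determined by the steps before turn \<open>t\<close>, hence
  independent of \<open>\<xi> t\<close>, and the expectation of the product factors.\<close>

lemma next_step_independent:
  fixes f :: "int \<Rightarrow> real"
  assumes half: "prob {\<omega> \<in> space M. \<xi> t \<omega> = a} = 1 / 2"
  defines "Y \<equiv> \<lambda>\<omega>. of_bool (alive t \<omega>) * f (pile t \<omega>)"
  shows "integrable M (\<lambda>\<omega>. Y \<omega> * of_bool (\<xi> t \<omega> = a))"
    and "expectation (\<lambda>\<omega>. Y \<omega> * of_bool (\<xi> t \<omega> = a)) = expectation Y / 2"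
proof -
  let ?P = "\<lambda>I. PiM I (\<lambda>_. count_space UNIV) :: (nat \<Rightarrow> int) measure"
  let ?R = "\<lambda>I \<omega>. restrict (\<lambda>i. \<xi> i \<omega>) I"
  let ?G = "\<lambda>r. of_bool (running n s r t) * f (chips s r t)"
  have [measurable]: "(\<lambda>r. chips s r t) \<in> measurable (?P {..<t}) (count_space UNIV)"
    "Measurable.pred (?P {..<t}) (\<lambda>r. running n s r t)"
    by (auto intro: measurable_chips measurable_running)
  have G: "?G \<in> borel_measurable (?P {..<t})" by measurable
  have H: "(\<lambda>r. of_bool (r t = a)) \<in> borel_measurable (?P {t})"
    by measurable
  have "indep_var (?P {..<t}) (?R {..<t}) (?P {t}) (?R {t})"
    by (intro indep_var_restrict[OF indep]) auto
  then have "indep_var borel (?G \<circ> ?R {..<t}) borel ((\<lambda>r. of_bool (r t = a)) \<circ> ?R {t})"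
    by (rule indep_var_compose[OF _ G H])
  \<comment> \<open>Forgetting the steps from index \<open>t\<close> on changes nothing, since the
    pile after \<open>t\<close> turns reads only indices below \<open>t\<close>.\<close>
  moreover have "?G \<circ> ?R {..<t} = Y"
    unfolding Y_def comp_def
    by (intro ext arg_cong2[where f="(*)"] arg_cong[where f=of_bool] arg_cong[where f=f]
        running_cong chips_cong) auto
  moreover have "(\<lambda>r. of_bool (r t = a)) \<circ> ?R {t} = (\<lambda>\<omega>. of_bool (\<xi> t \<omega> = a) :: real)"
    by (simp add: fun_eq_iff)
  ultimately have ind: "indep_var borel Y borel (\<lambda>\<omega>. of_bool (\<xi> t \<omega> = a) :: real)"
    by simp
  have 1: "integrable M Y" unfolding Y_def by (rule integrable_alive)
  have 2: "integrable M (\<lambda>\<omega>. of_bool (\<xi> t \<omega> = a) :: real)"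
    by (intro integrable_const_bound[where B=1]) auto
  show "integrable M (\<lambda>\<omega>. Y \<omega> * of_bool (\<xi> t \<omega> = a))"
    by (rule indep_var_integrable[OF ind 1 2])
  have "expectation (\<lambda>\<omega>. of_bool (\<xi> t \<omega> = a) :: real)
      = expectation (indicator {\<omega> \<in> space M. \<xi> t \<omega> = a})"
    by (intro Bochner_Integration.integral_cong) (auto simp: indicator_def)
  also have "\<dots> = 1 / 2" using half by simp
  finally show "expectation (\<lambda>\<omega>. Y \<omega> * of_bool (\<xi> t \<omega> = a)) = expectation Y / 2"
    using indep_var_lebesgue_integral[OF ind 1 2] by simp
qed

section \<open>The first-step equation in expectation\<close>

lemma h_first_step:
  assumes "0 \<le> x"
  shows "h (x + 1) + h (max 0 (x - int u)) = 2 * h x - 2"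
proof -
  have "real_of_int (C u (x + 1) + C u (max 0 (x - int u))) = real_of_int (2 * C u x + 1)"
    using C_first_step[OF assms] by simp
  then show ?thesis by (simp add: h_def algebra_simps)
qed

text \<open>Split by the value of \<open>\<xi> t\<close>. Independence gives each branch weight 1/2,
  and averaging the two branches by \<open>h_first_step\<close> loses exactly 1 wherever the game is
  still running.\<close>

lemma expectation_h_Suc:
  "expectation (\<lambda>\<omega>. of_bool (alive (Suc t) \<omega>) * h (pile (Suc t) \<omega>))
    = expectation (\<lambda>\<omega>. of_bool (alive t \<omega>) * h (pile t \<omega>)) - prob {\<omega> \<in> space M. alive t \<omega>}"
proof -
  let ?E = "\<lambda>f \<omega>. of_bool (alive t \<omega>) * f (pile t \<omega>) :: real"
  let ?up = "\<lambda>x. h (x + 1)" and ?down = "\<lambda>x. h (max 0 (x - int u))"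
  have "expectation (\<lambda>\<omega>. of_bool (alive (Suc t) \<omega>) * h (pile (Suc t) \<omega>))
     = expectation (\<lambda>\<omega>. ?E ?up \<omega> * of_bool (\<xi> t \<omega> = 1) + ?E ?down \<omega> * of_bool (\<xi> t \<omega> = - int u))"
  proof (rule integral_cong_AE)
    show "AE \<omega> in M. of_bool (alive (Suc t) \<omega>) * h (pile (Suc t) \<omega>)
      = ?E ?up \<omega> * of_bool (\<xi> t \<omega> = 1) + ?E ?down \<omega> * of_bool (\<xi> t \<omega> = - int u)"
      using AE_step
    proof eventually_elim
      case (elim \<omega>)
      have alive_Suc: "alive (Suc t) \<omega> \<longleftrightarrow> alive t \<omega> \<and> pile (Suc t) \<omega> < n"
        by (auto simp: running_def le_Suc_eq)
      have range: "alive t \<omega> \<Longrightarrow> pile t \<omega> < n" "0 \<le> pile t \<omega>"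
        using chips_nonneg[OF s(1)] by (auto simp: running_def)
      consider "\<xi> t \<omega> = 1" | "\<xi> t \<omega> = - int u" using elim by blast
      then show ?case
      proof cases
        case 1
        then have "pile (Suc t) \<omega> = pile t \<omega> + 1" using range by simp
        \<comment> \<open>If the up move reaches \<open>n\<close>, the game stops and the left side
          is 0; the up term on the right vanishes as well because \<open>h n = 0\<close>.\<close>
        moreover have "h n = 0" by (simp add: h_def)
        ultimately show ?thesis
          using 1 u alive_Suc range by (cases "pile t \<omega> + 1 = n") (auto simp del: chips.simps)
      next
        case 2
        \<comment> \<open>A down move from a pile in \<open>{0..<n}\<close> stays there, so a
          running game keeps running.\<close>
        then have "pile (Suc t) \<omega> = max 0 (pile t \<omega> - int u)" by simp
        then show ?thesis
          using 2 u alive_Suc range by (auto simp del: chips.simps)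
      qed
    qed
  qed measurable
  also have "\<dots> = expectation (?E ?up) / 2 + expectation (?E ?down) / 2"
    using next_step_independent[OF prob_up, of t ?up] next_step_independent[OF prob_down, of t ?down]
    by simp
  also have "\<dots> = expectation (\<lambda>\<omega>. (?E ?up \<omega> + ?E ?down \<omega>) / 2)"
    using integrable_alive[of t ?up] integrable_alive[of t ?down] by (simp add: add_divide_distrib)
  also have "\<dots> = expectation (\<lambda>\<omega>. ?E h \<omega> - indicator {\<omega> \<in> space M. alive t \<omega>} \<omega>)"
  proof (rule Bochner_Integration.integral_cong[OF refl])
    fix \<omega> assume "\<omega> \<in> space M"
    then show "(?E ?up \<omega> + ?E ?down \<omega>) / 2 = ?E h \<omega> - indicator {\<omega> \<in> space M. alive t \<omega>} \<omega>"
      using h_first_step[OF chips_nonneg[OF s(1), of "\<lambda>i. \<xi> i \<omega>" t]]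
      by (auto simp: indicator_def)
  qed
  also have "\<dots> = expectation (?E h) - prob {\<omega> \<in> space M. alive t \<omega>}"
    by (subst Bochner_Integration.integral_diff[OF integrable_alive])
      (auto intro!: integrable_real_indicator simp: emeasure_eq_measure simp del: indicator_simps)
  finally show ?thesis .
qed

section \<open>Summing the survival probabilities\<close>

lemma sum_prob_alive:
  "(\<Sum>k<t. prob {\<omega> \<in> space M. alive k \<omega>})
    = h s - expectation (\<lambda>\<omega>. of_bool (alive t \<omega>) * h (pile t \<omega>))"
proof (induction t)
  case 0
  \<comment> \<open>For \<open>s = n\<close> the game is over at turn 0, but then
    \<open>h s = 0\<close>, so both sides vanish.\<close>
  have "of_bool (alive 0 \<omega>) * h (pile 0 \<omega>) = h s" for \<omega>
    using s by (cases "s = n") (auto simp: running_def h_def)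
  then have "expectation (\<lambda>\<omega>. of_bool (alive 0 \<omega>) * h (pile 0 \<omega>)) = expectation (\<lambda>_. h s)"
    by (simp only:)
  then show ?case by (simp add: prob_space del: chips.simps)
qed (simp add: expectation_h_Suc del: chips.simps)

lemma prob_alive_sums: "(\<lambda>t. prob {\<omega> \<in> space M. alive t \<omega>}) sums h s"
proof -
  let ?E = "\<lambda>t. expectation (\<lambda>\<omega>. of_bool (alive t \<omega>) * h (pile t \<omega>))"
  let ?p = "\<lambda>t. prob {\<omega> \<in> space M. alive t \<omega>}"
  have h_alive: "0 \<le> h (pile t \<omega>)" "h (pile t \<omega>) \<le> h 0" if "alive t \<omega>" for t \<omega>
  proof -
    have "0 \<le> pile t \<omega>" "pile t \<omega> \<le> n"
      using that chips_nonneg[OF s(1)] by (force simp: running_def)+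
    then show "0 \<le> h (pile t \<omega>)" "h (pile t \<omega>) \<le> h 0"
      by (auto simp: h_def C_mono)
  qed
  have E_nonneg: "0 \<le> ?E t" for t
    by (intro Bochner_Integration.integral_nonneg) (auto simp: h_alive)
  have E_le: "?E t \<le> h 0 * ?p t" for t
  proof -
    have "?E t \<le> expectation (\<lambda>\<omega>. h 0 * indicator {\<omega> \<in> space M. alive t \<omega>} \<omega>)"
      by (intro integral_mono integrable_alive integrable_mult_right integrable_real_indicator)
        (auto simp: indicator_def h_alive emeasure_eq_measure)
    also have "\<dots> = h 0 * expectation (indicator {\<omega> \<in> space M. alive t \<omega>})"
      by (rule integral_mult_right_zero)
    also have "expectation (indicator {\<omega> \<in> space M. alive t \<omega>}) = ?p t"
      unfolding Bochner_Integration.integral_indicator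
      by (rule arg_cong[where f=prob]) blast
    finally show ?thesis .
  qed
  \<comment> \<open>Since the error term is nonnegative, \<open>h s\<close> bounds all partial sums.
    Almost sure termination is thus a consequence, not an assumption.\<close>
  have "summable ?p"
    using E_nonneg sum_prob_alive by (intro summableI_nonneg_bounded[where x="h s"]) auto
  then have "?p \<longlonglongrightarrow> 0" by (rule summable_LIMSEQ_zero)
  then have "(\<lambda>t. h 0 * ?p t) \<longlonglongrightarrow> 0" by (rule tendsto_mult_right_zero)
  \<comment> \<open>The error is squeezed between 0 and \<open>h 0 * ?p t\<close>.\<close>
  then have "?E \<longlonglongrightarrow> 0"
    by (rule tendsto_sandwich[OF _ _ tendsto_const, rotated 2])
      (intro always_eventually allI E_nonneg E_le)+
  then have "(\<lambda>t. h s - ?E t) \<longlonglongrightarrow> h s - 0" by (intro tendsto_intros)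
  then show ?thesis by (simp add: sums_def sum_prob_alive)
qed

section \<open>The expected number of turns\<close>

lemma measurable_turns [measurable]:
  "(\<lambda>\<omega>. turns n s (\<lambda>t. \<xi> t \<omega>)) \<in> measurable M (count_space UNIV)"
proof -
  \<comment> \<open>The infimum in \<open>turns\<close> ranges over a path-dependent set. Giving
    misses the value \<infinity> makes it a countable infimum over a fixed index set.\<close>
  have eq: "turns n s r = (INF t. if chips s r t = n then enat t else \<infinity>)" for r
  proof (rule antisym)
    show "turns n s r \<le> (INF t. if chips s r t = n then enat t else \<infinity>)"
      unfolding turns_def by (rule INF_greatest) (auto intro: INF_lower)
    show "(INF t. if chips s r t = n then enat t else \<infinity>) \<le> turns n s r"
      unfolding turns_def
    proof (rule INF_greatest)
      fix t assume "t \<in> {t. chips s r t = n}"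
      then show "(INF t. if chips s r t = n then enat t else \<infinity>) \<le> enat t"
        by (intro INF_lower2[of t]) simp_all
    qed
  qed
  show ?thesis
    unfolding eq by (intro measurable_INF measurable_If measurable_const) simp_all
qed

text \<open>Tail-sum formula: the expectation is the sum over \<open>t\<close> of the probabilities
  that the number of turns exceeds \<open>t\<close>.\<close>

theorem expectation_turns:
  "(\<integral>\<^sup>+ \<omega>. ennreal_of_enat (turns n s (\<lambda>t. \<xi> t \<omega>)) \<partial>M) = ennreal (h s)"
proof -
  have "(\<integral>\<^sup>+ \<omega>. ennreal_of_enat (turns n s (\<lambda>t. \<xi> t \<omega>)) \<partial>M)
    = (\<Sum>t. emeasure M {\<omega> \<in> space M. enat t < turns n s (\<lambda>t. \<xi> t \<omega>)})"
    by (rule nn_integral_enat_function) measurable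
  also have "\<dots> = (\<Sum>t. ennreal (prob {\<omega> \<in> space M. alive t \<omega>}))"
  proof (rule suminf_cong)
    fix t
    \<comment> \<open>The two events agree only almost surely: a path with an upward step larger
      than 1 could jump over \<open>n\<close>.\<close>
    have "emeasure M {\<omega> \<in> space M. enat t < turns n s (\<lambda>t. \<xi> t \<omega>)} = emeasure M {\<omega> \<in> space M. alive t \<omega>}"
    proof (rule emeasure_eq_AE)
      show "AE \<omega> in M. \<omega> \<in> {\<omega> \<in> space M. enat t < turns n s (\<lambda>t. \<xi> t \<omega>)} \<longleftrightarrow> \<omega> \<in> {\<omega> \<in> space M. alive t \<omega>}"
        using AE_step
      proof eventually_elim
        case (elim \<omega>)
        have "\<xi> t \<omega> \<le> 1" for t using elim[rule_format, of t] by auto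
        then show ?case
          using s by (simp add: less_turns_iff running_iff)
      qed
    qed measurable
    then show "emeasure M {\<omega> \<in> space M. enat t < turns n s (\<lambda>t. \<xi> t \<omega>)} = ennreal (prob {\<omega> \<in> space M. alive t \<omega>})"
      by (simp add: emeasure_eq_measure)
  qed
  also have "\<dots> = ennreal (h s)"
    using prob_alive_sums by (intro suminf_ennreal_eq) auto
  finally show ?thesis .
qed

end

theorem proposition11:
  fixes M :: "'a measure" and \<xi> :: "nat \<Rightarrow> 'a \<Rightarrow> int" and u :: nat and n s :: int
  assumes "prob_space M"
    and "u \<ge> 1"
    and "prob_space.indep_vars M (\<lambda>_. count_space UNIV) \<xi> UNIV"
    and "\<And>t. measure M {\<omega> \<in> space M. \<xi> t \<omega> = 1} = 1 / 2"
    and "\<And>t. measure M {\<omega> \<in> space M. \<xi> t \<omega> = - int u} = 1 / 2"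
    and "0 \<le> s" and "s \<le> n"
  shows "enn2ereal (\<integral>\<^sup>+ \<omega>. ennreal_of_enat (turns n s (\<lambda>t. \<xi> t \<omega>)) \<partial>M)
           = ereal (2 * (real_of_int (C u n) - real_of_int (C u s)))"
proof -
  interpret pile_game M \<xi> u n s
    using assms by (intro pile_game.intro pile_game_axioms.intro)
  \<comment> \<open>\<open>ennreal\<close> sends negative reals to 0, so nonnegativity is what
    allows the return to \<open>ereal\<close>.\<close>
  have "0 \<le> h s" using C_mono[OF assms(7)] by (simp add: h_def)
  then show ?thesis by (simp add: expectation_turns enn2ereal_ennreal h_def)
qed

end
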